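(* Let $P(x)=x^2+k_2$ be a real polynomial with $k_2\neq 0$. Then $P(x)$ is $\mathcal{R}$ if and only if $P(x)$ is $\mathcal{IR}$.
   Context: A monic real polynomial $P(x)$ of degree $n$ is realizable ($\mathcal{R}$) if it is the characteristic polynomial of some $n\times n$ entrywise nonnegative matrix; it is irreducibly realizable ($\mathcal{IR}$) if it is the characteristic polynomial of some $n\times n$ irreducible entrywise nonnegative matrix. A square matrix is irreducible if it is not similar by a permutation matrix to a nontrivially block triangular matrix (equivalently, its digraph is strongly connected). *)

theory Defs
  imports "Jordan_Normal_Form.Char_Poly"
begin

definition nonneg_mat :: "real mat \<Rightarrow> bool" where
  "nonneg_mat A \<longleftrightarrow> (\<forall>i < dim_row A. \<forall>j < dim_col A. 0 \<le> A $$ (i, j))"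

definition permutation_mat :: "nat \<Rightarrow> real mat \<Rightarrow> bool" where
  "permutation_mat n P \<longleftrightarrow>
     (\<exists>p. p permutes {..<n} \<and> P = mat n n (\<lambda>(i, j). if i = p j then 1 else 0))"

definition block_triangular_mat :: "real mat \<Rightarrow> bool" where
  "block_triangular_mat T \<longleftrightarrow>
     (\<exists>r s B C D. 0 < r \<and> 0 < s \<and>
        B \<in> carrier_mat r r \<and> C \<in> carrier_mat r s \<and> D \<in> carrier_mat s s \<and>
        T = four_block_mat B C (0\<^sub>m s r) D)"

text \<open>
  Every 1 by 1 matrix, including the zero matrix, is irreducible. The 0 by 0 matrix is not,
  in agreement with the convention that a strongly connected digraph has at least one vertex.
  Upper block triangular form suffices: reversing the order of the indices turns a lower block
  triangular matrix into an upper one.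
\<close>

definition irreducible_mat :: "real mat \<Rightarrow> bool" where
  "irreducible_mat A \<longleftrightarrow> square_mat A \<and> 0 < dim_row A \<and>
     \<not> (\<exists>T P Q. permutation_mat (dim_row A) P \<and> similar_mat_wit A T P Q \<and>
            block_triangular_mat T)"

text \<open>
  A characteristic polynomial is monic and its degree is the dimension of the matrix, so
  monicity of \<open>P\<close> is implied in the next two definitions.
\<close>

definition realizable :: "real poly \<Rightarrow> bool" where
  "realizable P \<longleftrightarrow>
     (\<exists>A \<in> carrier_mat (degree P) (degree P). nonneg_mat A \<and> char_poly A = P)"

definition irreducibly_realizable :: "real poly \<Rightarrow> bool" where
  "irreducibly_realizable P \<longleftrightarrow>
     (\<exists>A \<in> carrier_mat (degree P) (degree P).
        nonneg_mat A \<and> irreducible_mat A \<and> char_poly A = P)"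

end

theory Submission
  imports Defs
begin

text \<open>
  Vanishing trace forces a nonnegative realizing matrix to have zero diagonal; its determinant
  \<open>k\<^sub>2\<close> is then minus the product of the two off-diagonal entries, which are therefore both
  nonzero. Hence every realizing matrix is already irreducible.
\<close>

lemma det_dim_two:
  fixes M :: "'a :: comm_ring_1 mat"
  assumes M: "M \<in> carrier_mat 2 2"
  shows "det M = M $$ (0, 0) * M $$ (1, 1) - M $$ (1, 0) * M $$ (0, 1)"
proof -
  have expand: "det M = (\<Sum>i<2. M $$ (i, 0) * cofactor M i 0)"
    by (rule laplace_expansion_column[OF M]) simp
  have minor: "mat_delete M i 0 \<in> carrier_mat 1 1" for i
    using mat_delete_carrier[OF M] by simp
  have cofactors: "cofactor M 0 0 = M $$ (1, 1)" "cofactor M 1 0 = - M $$ (0, 1)"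
    unfolding cofactor_def det_single[OF minor] using M by (simp_all add: mat_delete_def)
  show ?thesis
    unfolding expand lessThan_Suc numeral_2_eq_2 using cofactors by simp
qed

text \<open>This turns an equation of polynomials into two equations between matrix entries, one for
  the determinant and one for the trace.\<close>

lemma char_poly_dim_two:
  fixes A :: "'a :: comm_ring_1 mat"
  assumes A: "A \<in> carrier_mat 2 2"
  shows "char_poly A =
    [:A $$ (0, 0) * A $$ (1, 1) - A $$ (0, 1) * A $$ (1, 0), - (A $$ (0, 0) + A $$ (1, 1)), 1:]"
proof -
  have "char_poly_matrix A \<in> carrier_mat 2 2"
    using A by simp
  then show ?thesis
    using A by (simp add: char_poly_def det_dim_two char_poly_matrix_def)
qed

text \<open>A permutation similarity only relabels indices, so it carries off-diagonal entries to
  off-diagonal entries. A block triangular form has a zero in its lower left corner, which would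
  have to come from an off-diagonal zero of \<open>A\<close>. For \<open>n = 1\<close> no block
  triangular form exists.\<close>

lemma irreducible_mat_if_offdiag_nonzero:
  assumes A: "A \<in> carrier_mat n n" and "0 < n"
    and offdiag: "\<And>i j. \<lbrakk>i < n; j < n; i \<noteq> j\<rbrakk> \<Longrightarrow> A $$ (i, j) \<noteq> 0"
  shows "irreducible_mat A"
proof -
  have False
    if perm: "permutation_mat n P" and sim: "similar_mat_wit A T P Q"
      and block: "block_triangular_mat T" for P Q T
  proof -
    obtain p where p: "p permutes {..<n}"
      and P_eq: "P = mat n n (\<lambda>(i, j). if i = p j then 1 else 0)"
      using perm by (auto simp: permutation_mat_def)
    have carr: "T \<in> carrier_mat n n" "P \<in> carrier_mat n n" "Q \<in> carrier_mat n n"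
      and QP: "Q * P = 1\<^sub>m n" and A_eq: "A = P * T * Q"
      using similar_mat_witD2[OF A sim] by auto
    \<comment> \<open>Both diagonal blocks are nonempty, so the last row and the first column meet
      inside the zero block.\<close>
    have n2: "2 \<le> n" and T0: "T $$ (n - 1, 0) = 0"
      using block carr(1) by (auto simp: block_triangular_mat_def)
    have p_less: "p j < n" if "j < n" for j
      using permutes_in_image[OF p, of j] that by simp
    have p_eq_iff: "p i = p j \<longleftrightarrow> i = j" for i j
      using permutes_inj[OF p] by (auto dest: injD)
    \<comment> \<open>Moving \<open>Q\<close> to the other side leaves only products with
      \<open>P\<close>, whose entries are explicit.\<close>
    have "A * P = P * T * (Q * P)"
      unfolding A_eq using carr by (simp add: assoc_mult_mat[of _ n n _ n _ n])
    also have "\<dots> = P * T"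
      unfolding QP using carr by simp
    finally have AP: "A * P = P * T" .
    \<comment> \<open>Column \<open>0\<close> of \<open>P\<close> is the unit vector at
      \<open>p 0\<close>, so the product selects column \<open>p 0\<close> of
      \<open>A\<close>.\<close>
    have "A $$ (p (n - 1), p 0) = (A * P) $$ (p (n - 1), 0)"
      using A n2 p_less[of 0] p_less[of "n - 1"]
      by (simp add: P_eq scalar_prod_def if_distrib cong: if_cong)
    \<comment> \<open>By injectivity of \<open>p\<close>, row \<open>p (n - 1)\<close> of
      \<open>P\<close> has its only \<open>1\<close> in column \<open>n - 1\<close>, so the product
      selects the last row of \<open>T\<close>.\<close>
    also have "\<dots> = T $$ (n - 1, 0)"
      unfolding AP using carr(1) n2 p_less[of "n - 1"]
      by (simp add: P_eq scalar_prod_def p_eq_iff if_distrib[of "\<lambda>x. x * _"]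
          cong: if_cong)
    finally have "A $$ (p (n - 1), p 0) = 0"
      using T0 by simp
    moreover have "p (n - 1) \<noteq> p 0"
      using n2 by (simp add: p_eq_iff)
    ultimately show False
      using offdiag n2 p_less by simp
  qed
  then show ?thesis
    using A \<open>0 < n\<close> by (auto simp: irreducible_mat_def)
qed

theorem corollary23:
  fixes P :: "real poly" and k\<^sub>2 :: real
  assumes "P = [:k\<^sub>2, 0, 1:]"
    and "k\<^sub>2 \<noteq> 0"
  shows "realizable P \<longleftrightarrow> irreducibly_realizable P"
proof
  assume "realizable P"
  then obtain A where A: "A \<in> carrier_mat 2 2" and nonneg: "nonneg_mat A"
    and char: "char_poly A = P"
    using assms(1) by (auto simp: realizable_def numeral_2_eq_2)
  have diag_nonneg: "0 \<le> A $$ (0, 0)" "0 \<le> A $$ (1, 1)"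
    using A nonneg by (auto simp: nonneg_mat_def)
  \<comment> \<open>The constant coefficient of \<open>P\<close> gives the first equation, the
    vanishing linear coefficient the second.\<close>
  have coeffs: "A $$ (0, 0) * A $$ (1, 1) - A $$ (0, 1) * A $$ (1, 0) = k\<^sub>2"
    "A $$ (0, 0) + A $$ (1, 1) = 0"
    using char assms(1) unfolding char_poly_dim_two[OF A] by auto
  have "A $$ (0, 0) = 0"
    using diag_nonneg coeffs(2) by linarith
  then have "A $$ (0, 1) \<noteq> 0" "A $$ (1, 0) \<noteq> 0"
    using coeffs(1) assms(2) by auto
  then have "irreducible_mat A"
    using A by (intro irreducible_mat_if_offdiag_nonzero[of A 2]) (auto simp: less_2_cases_iff)
  then show "irreducibly_realizable P"
    using A nonneg char assms(1) by (auto simp: irreducibly_realizable_def numeral_2_eq_2)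
next
  assume "irreducibly_realizable P"
  then show "realizable P"
    by (auto simp: irreducibly_realizable_def realizable_def)
qed

end
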